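(* Let $(X,f_{1,\infty})$ be a finitely generated non-autonomous discrete system with $X$ a compact metric space. If $f_{1,\infty}$ is topologically transitive and commutative, then $f_{1,\infty}$ is either sensitive or almost equicontinuous.
   Context: $\mathbb{N}=\{1,2,3,\dots\}$, $\mathbb{Z}_+=\{0,1,2,\dots\}$. A non-autonomous discrete system (NDS) $(X,f_{1,\infty})$ consists of a metric space $(X,d)$ and a sequence $f_{1,\infty}=(f_n)_{n=1}^\infty$ of continuous maps $f_n:X\to X$. For $i,n\in\mathbb{N}$, $f_i^n:=f_{i+n-1}\circ\cdots\circ f_i$, and $f_i^0=\mathrm{id}_X$. Finitely generated: there is a finite set $F$ of continuous self-maps of $X$ such that every $f_i$ belongs to $F$. Commutative: $f_i\circ f_j=f_j\circ f_i$ for all $i,j\in\mathbb{N}$. Topologically transitive: for any two non-empty open sets $U,V\subseteq X$ there is $n\in\mathbb{N}$ with $f_1^n(U)\cap V\neq\emptyset$. Sensitive: there is $\delta>0$ such that for any non-empty open set $U\subseteq X$ there exist $x,y\in U$ and $n\in\mathbb{N}$ with $d(f_1^n(x),f_1^n(y))>\delta$. Equicontinuity point: $x\in X$ such that for any $\varepsilon>0$ there is $\delta>0$ such that for all $y\in B(x,\delta)$ and all $n\in\mathbb{Z}_+$, $d(f_1^n(x),f_1^n(y))<\varepsilon$. Almost equicontinuous: the set of equicontinuity points is dense in $X$. *)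

theory Defs
  imports "HOL-Analysis.Analysis"
begin

(* The space X is the whole type 'a.  The sequence of maps is f 1, f 2, ...; the value
   f 0 is junk and is never constrained or used, so every index below ranges over i >= 1. *)

definition nds :: "(nat \<Rightarrow> 'a::metric_space \<Rightarrow> 'a) \<Rightarrow> bool" where
  "nds f \<longleftrightarrow> (\<forall>i\<ge>1. continuous_on UNIV (f i))"

(* nds_iter f i n = f (i + n - 1) o ... o f i *)
primrec nds_iter :: "(nat \<Rightarrow> 'a \<Rightarrow> 'a) \<Rightarrow> nat \<Rightarrow> nat \<Rightarrow> 'a \<Rightarrow> 'a" where
  "nds_iter f i 0 = id"
| "nds_iter f i (Suc n) = f (i + n) \<circ> nds_iter f i n"

definition finitely_generated :: "(nat \<Rightarrow> 'a::metric_space \<Rightarrow> 'a) \<Rightarrow> bool" where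
  "finitely_generated f \<longleftrightarrow>
     (\<exists>F. finite F \<and> (\<forall>g\<in>F. continuous_on UNIV g) \<and> (\<forall>i\<ge>1. f i \<in> F))"

definition commutative_nds :: "(nat \<Rightarrow> 'a \<Rightarrow> 'a) \<Rightarrow> bool" where
  "commutative_nds f \<longleftrightarrow> (\<forall>i\<ge>1. \<forall>j\<ge>1. f i \<circ> f j = f j \<circ> f i)"

definition topologically_transitive :: "(nat \<Rightarrow> 'a::metric_space \<Rightarrow> 'a) \<Rightarrow> bool" where
  "topologically_transitive f \<longleftrightarrow>
     (\<forall>U V. open U \<and> U \<noteq> {} \<and> open V \<and> V \<noteq> {} \<longrightarrow>
        (\<exists>n\<ge>1. nds_iter f 1 n ` U \<inter> V \<noteq> {}))"

definition sensitive :: "(nat \<Rightarrow> 'a::metric_space \<Rightarrow> 'a) \<Rightarrow> bool" where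
  "sensitive f \<longleftrightarrow>
     (\<exists>\<delta>>0. \<forall>U. open U \<and> U \<noteq> {} \<longrightarrow>
        (\<exists>x\<in>U. \<exists>y\<in>U. \<exists>n\<ge>1. dist (nds_iter f 1 n x) (nds_iter f 1 n y) > \<delta>))"

definition equicontinuity_point :: "(nat \<Rightarrow> 'a::metric_space \<Rightarrow> 'a) \<Rightarrow> 'a \<Rightarrow> bool" where
  "equicontinuity_point f x \<longleftrightarrow>
     (\<forall>\<epsilon>>0. \<exists>\<delta>>0. \<forall>y\<in>ball x \<delta>. \<forall>n. dist (nds_iter f 1 n x) (nds_iter f 1 n y) < \<epsilon>)"

definition almost_equicontinuous :: "(nat \<Rightarrow> 'a::metric_space \<Rightarrow> 'a) \<Rightarrow> bool" where
  "almost_equicontinuous f \<longleftrightarrow> closure {x. equicontinuity_point f x} = UNIV"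

end

theory Submission
  imports Defs
begin

text \<open>
  Write \<open>t n\<close> for \<open>f_1^n\<close>, and suppose that the system is not sensitive, so that for every
  \<open>\<epsilon>\<close> there is a non-empty open \<open>U\<close> all of whose iterates have diameter at most \<open>\<epsilon>\<close>.
  The maps \<open>t n\<close> are surjective. Hence, given \<open>p\<close> and \<open>q\<close>, transitivity from
  \<open>(t q)\<^sup>-\<^sup>1 U\<close> to \<open>(t p)\<^sup>-\<^sup>1 U\<close> yields \<open>m\<close> and an open set of points \<open>x\<close> such that \<open>t q x\<close> and
  \<open>t p (t m x)\<close> both lie in \<open>U\<close>. Applying \<open>t r\<close>, commuting, and using transitivity again, one
  finds that \<open>t q\<close> and \<open>t p \<circ> t m\<close> are \<open>\<epsilon>\<close>-close uniformly on \<open>X\<close>. Now if \<open>V\<close> is open and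
  \<open>t p\<close> maps some point of \<open>V\<close> into \<open>U\<close>, then \<open>t q\<close> on \<open>V \<inter> (t p)\<^sup>-\<^sup>1 U\<close> is \<open>\<epsilon>\<close>-close to \<open>t m \<circ> t p\<close>,
  which has image of diameter at most \<open>\<epsilon>\<close>; so all iterates of this subset of \<open>V\<close> have diameter
  at most \<open>3\<epsilon>\<close>. Thus for each \<open>\<epsilon>\<close> the union of the open sets with this property is dense, and by
  Baire's theorem these unions, over \<open>\<epsilon> = 1/n\<close>, have dense intersection.
\<close>

definition stable_set :: "(nat \<Rightarrow> 'a::metric_space \<Rightarrow> 'a) \<Rightarrow> real \<Rightarrow> 'a set \<Rightarrow> bool" where
  "stable_set f \<epsilon> U \<longleftrightarrow> (\<forall>n. \<forall>x\<in>U. \<forall>y\<in>U. dist (nds_iter f 1 n x) (nds_iter f 1 n y) \<le> \<epsilon>)"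

lemma stable_setD:
  "stable_set f \<epsilon> U \<Longrightarrow> x \<in> U \<Longrightarrow> y \<in> U \<Longrightarrow> dist (nds_iter f 1 n x) (nds_iter f 1 n y) \<le> \<epsilon>"
  by (simp add: stable_set_def)

lemma transitiveE:
  assumes "topologically_transitive f" "open U" "U \<noteq> {}" "open V" "V \<noteq> {}"
  obtains n x where "n \<ge> 1" "x \<in> U" "nds_iter f 1 n x \<in> V"
  using assms unfolding topologically_transitive_def by blast

lemma generator_iter_commute:
  assumes "commutative_nds f" "i \<ge> 1"
  shows "f i (nds_iter f 1 n x) = nds_iter f 1 n (f i x)"
proof (induction n)
  case (Suc n)
  have "f i (f (1 + n) y) = f (1 + n) (f i y)" for y
    using assms unfolding commutative_nds_def by (metis comp_apply le_add1)
  then show ?case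
    using Suc by simp
qed simp

lemma iter_commute:
  assumes "commutative_nds f"
  shows "nds_iter f 1 m (nds_iter f 1 n x) = nds_iter f 1 n (nds_iter f 1 m x)"
proof (induction m)
  case (Suc m)
  then show ?case
    using generator_iter_commute[OF assms, of "1 + m"] by simp
qed simp

lemma continuous_on_iter:
  assumes "nds f"
  shows "continuous_on UNIV (nds_iter f 1 n)"
proof (induction n)
  case (Suc n)
  have "continuous_on UNIV (f (1 + n))"
    using assms by (simp add: nds_def)
  then show ?case
    using Suc continuous_on_compose continuous_on_subset
    by (metis nds_iter.simps(2) subset_UNIV)
qed (simp add: id_def)

lemma open_iter_vimage:
  assumes "nds f" "open U"
  shows "open (nds_iter f 1 n -` U)"
  using assms continuous_on_iter open_vimage by blast

text \<open>Once \<open>n \<ge> i\<close>, the composition contains the factor \<open>f i\<close>,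
  which commutativity moves to the outermost place.\<close>

lemma iter_factor:
  assumes "commutative_nds f" "i \<ge> 1" "n \<ge> i"
  shows "nds_iter f 1 n x \<in> range (f i)"
  using assms(3)
proof (induction n rule: dec_induct)
  case base
  obtain k where "i = Suc k"
    using assms(2) by (cases i) auto
  then show ?case by simp
next
  case (step n)
  then obtain y where "nds_iter f 1 n x = f i y" by auto
  moreover have "f (1 + n) (f i y) = f i (f (1 + n) y)"
    using assms(1,2) unfolding commutative_nds_def by (metis comp_apply le_add1)
  ultimately show ?case by simp
qed

text \<open>
  A ball \<open>B\<close> whose closure misses \<open>range (f i)\<close> is only hit by the finitely many \<open>t n\<close> with
  \<open>n < i\<close>, so the finitely many closed sets \<open>(t n)\<^sup>-\<^sup>1 (closure B)\<close> cover \<open>X\<close>; but a point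
  \<open>f i y\<close> cannot lie in any of them, because \<open>t n (f i y) = f i (t n y)\<close>.
\<close>

lemma surj_generator:
  fixes f :: "nat \<Rightarrow> 'a::metric_space \<Rightarrow> 'a"
  assumes "compact (UNIV :: 'a set)" "nds f" "topologically_transitive f" "commutative_nds f" "i \<ge> 1"
  shows "surj (f i)"
proof (rule ccontr)
  assume "\<not> surj (f i)"
  then obtain v where v: "v \<notin> range (f i)" by blast
  have "closed (range (f i))"
    using assms(1,2,5) by (auto simp: nds_def intro: compact_imp_closed compact_continuous_image)
  then obtain e where e: "e > 0" "ball v e \<subseteq> - range (f i)"
    using v by (metis ComplI closed_def open_contains_ball)
  define C where "C = cball v (e / 2)"
  have "C \<subseteq> ball v e"
    using e(1) by (auto simp: C_def)
  then have C: "closed C" "C \<inter> range (f i) = {}"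
    using e(2) by (auto simp: C_def)
  define K where "K = (\<Union>n<i. nds_iter f 1 n -` C)"
  have "closed K"
    unfolding K_def using C(1) continuous_on_iter[OF assms(2)]
    by (intro closed_UN) (auto intro: closed_vimage)
  moreover have "- K = {}"
  proof (rule ccontr)
    assume "- K \<noteq> {}"
    moreover have "ball v (e / 2) \<noteq> {}"
      using e(1) by simp
    ultimately obtain n x where n: "x \<in> - K" "nds_iter f 1 n x \<in> ball v (e / 2)"
      using transitiveE[OF assms(3) open_Compl[OF \<open>closed K\<close>] _ open_ball] by blast
    then have "nds_iter f 1 n x \<in> C"
      by (simp add: C_def)
    moreover from this have "n < i"
      using iter_factor[OF assms(4,5), of n x] C(2) by force
    ultimately show False
      using n(1) by (auto simp: K_def)
  qed
  ultimately obtain n where "nds_iter f 1 n (f i v) \<in> C"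
    by (auto simp: K_def)
  then show False
    using generator_iter_commute[OF assms(4,5), of n v] C(2) by (metis disjoint_iff rangeI)
qed

lemma surj_iter:
  fixes f :: "nat \<Rightarrow> 'a::metric_space \<Rightarrow> 'a"
  assumes "compact (UNIV :: 'a set)" "nds f" "topologically_transitive f" "commutative_nds f"
  shows "surj (nds_iter f 1 n)"
proof (induction n)
  case (Suc n)
  then show ?case
    using surj_generator[OF assms, of "1 + n"] comp_surj[of "nds_iter f 1 n" "f (1 + n)"] by simp
qed simp

lemma iter_uniformly_close:
  fixes f :: "nat \<Rightarrow> 'a::metric_space \<Rightarrow> 'a"
  assumes cpt: "compact (UNIV :: 'a set)" and nds: "nds f"
    and trans: "topologically_transitive f" and comm: "commutative_nds f"
    and U: "open U" "U \<noteq> {}" "stable_set f \<epsilon> U"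
  obtains m where "\<And>z. dist (nds_iter f 1 q z) (nds_iter f 1 m (nds_iter f 1 p z)) \<le> \<epsilon>"
proof -
  let ?t = "nds_iter f 1"
  have vimage_ne: "?t n -` U \<noteq> {}" for n
    using surj_iter[OF cpt nds trans comm, of n] U(2) by (metis ex_in_conv surjD vimageI)
  obtain m x where m: "?t q x \<in> U" "?t p (?t m x) \<in> U"
    using transitiveE[OF trans open_iter_vimage[OF nds U(1)] vimage_ne
        open_iter_vimage[OF nds U(1)] vimage_ne] by (metis vimageD)
  define W where "W = ?t q -` U \<inter> ?t m -` (?t p -` U)"
  have W: "open W" "W \<noteq> {}"
    using m unfolding W_def by (blast intro: open_Int open_iter_vimage[OF nds] U(1))+
  \<comment> \<open>\<open>D\<close> collects the points violating the bound. The strict inequality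
    makes it open, so transitivity would bring a point of \<open>W\<close> into it.\<close>
  define D where "D = {z. dist (?t q z) (?t m (?t p z)) > \<epsilon>}"
  have "continuous_on UNIV (\<lambda>z. ?t m (?t p z))"
    using continuous_on_compose2[OF continuous_on_iter[OF nds] continuous_on_iter[OF nds]] by blast
  then have "open D"
    unfolding D_def by (intro open_Collect_less continuous_intros continuous_on_iter[OF nds])
  have "D = {}"
  proof (rule ccontr)
    assume "D \<noteq> {}"
    then obtain r y where y: "y \<in> W" "?t r y \<in> D"
      using transitiveE[OF trans W \<open>open D\<close>] by blast
    have "dist (?t r (?t q y)) (?t r (?t p (?t m y))) \<le> \<epsilon>"
      using y(1) by (intro stable_setD[OF U(3)]) (auto simp: W_def)
    also have "?t r (?t q y) = ?t q (?t r y)"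
      by (rule iter_commute[OF comm])
    also have "?t r (?t p (?t m y)) = ?t m (?t p (?t r y))"
      using iter_commute[OF comm] by metis
    finally show False
      using y(2) by (simp add: D_def)
  qed
  then show thesis
    by (intro that[of m]) (auto simp: D_def not_less)
qed

lemma stable_subset:
  fixes f :: "nat \<Rightarrow> 'a::metric_space \<Rightarrow> 'a"
  assumes cpt: "compact (UNIV :: 'a set)" and nds: "nds f"
    and trans: "topologically_transitive f" and comm: "commutative_nds f"
    and U: "open U" "U \<noteq> {}" "stable_set f (\<epsilon> / 3) U"
    and V: "open V" "V \<noteq> {}"
  obtains V' where "open V'" "V' \<noteq> {}" "V' \<subseteq> V" "stable_set f \<epsilon> V'"
proof -
  let ?t = "nds_iter f 1"
  obtain p x where p: "x \<in> V" "?t p x \<in> U"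
    using transitiveE[OF trans V U(1,2)] by blast
  define V' where "V' = V \<inter> ?t p -` U"
  have "stable_set f \<epsilon> V'"
    unfolding stable_set_def
  proof (intro allI ballI)
    fix q y z assume yz: "y \<in> V'" "z \<in> V'"
    \<comment> \<open>\<open>m\<close> depends on \<open>q\<close>, but \<open>V'\<close> was fixed
      through \<open>p\<close> alone, so one set serves all iterates.\<close>
    obtain m where m: "\<And>z. dist (?t q z) (?t m (?t p z)) \<le> \<epsilon> / 3"
      using iter_uniformly_close[OF cpt nds trans comm U] by blast
    have "dist (?t m (?t p y)) (?t m (?t p z)) \<le> \<epsilon> / 3"
      using yz by (intro stable_setD[OF U(3)]) (auto simp: V'_def)
    moreover have "dist (?t q y) (?t q z) \<le> dist (?t q y) (?t m (?t p y))
        + dist (?t m (?t p y)) (?t m (?t p z)) + dist (?t q z) (?t m (?t p z))"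
      using dist_triangle[of "?t q y" "?t q z" "?t m (?t p y)"]
        dist_triangle2[of "?t m (?t p y)" "?t q z" "?t m (?t p z)"] by linarith
    ultimately show "dist (?t q y) (?t q z) \<le> \<epsilon>"
      using m[of y] m[of z] by linarith
  qed
  moreover have "open V'" "V' \<noteq> {}"
    using p V(1) open_iter_vimage[OF nds U(1)] by (auto simp: V'_def)
  ultimately show thesis
    using that by (simp add: V'_def)
qed

lemma not_sensitive_stable_set:
  assumes "\<not> sensitive f" "\<epsilon> > 0"
  obtains U where "open U" "U \<noteq> {}" "stable_set f \<epsilon> U"
proof -
  obtain U where U: "open U" "U \<noteq> {}"
    and small: "\<And>x y n. x \<in> U \<Longrightarrow> y \<in> U \<Longrightarrow> n \<ge> 1 \<Longrightarrow> dist (nds_iter f 1 n x) (nds_iter f 1 n y) \<le> \<epsilon>"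
    using assms unfolding sensitive_def by (meson not_less)
  obtain u where u: "u \<in> U" using U(2) by blast
  \<comment> \<open>\<open>sensitive\<close> concerns only \<open>n \<ge> 1\<close>; the ball
    settles \<open>n = 0\<close>, where the iterate is the identity.\<close>
  have "stable_set f \<epsilon> (U \<inter> ball u (\<epsilon> / 2))"
    unfolding stable_set_def
  proof (intro allI ballI)
    fix n x y assume xy: "x \<in> U \<inter> ball u (\<epsilon> / 2)" "y \<in> U \<inter> ball u (\<epsilon> / 2)"
    show "dist (nds_iter f 1 n x) (nds_iter f 1 n y) \<le> \<epsilon>"
    proof (cases n)
      case 0
      then show ?thesis
        using xy dist_triangle_half_r[of u x \<epsilon> y] by simp
    next
      case (Suc k)
      then show ?thesis using small[of x y n] xy by simp
    qed
  qed
  moreover have "u \<in> U \<inter> ball u (\<epsilon> / 2)"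
    using u assms(2) by simp
  ultimately show thesis
    using that[of "U \<inter> ball u (\<epsilon> / 2)"] U(1) by blast
qed

lemma equicontinuity_pointI:
  assumes "\<And>\<epsilon>. \<epsilon> > 0 \<Longrightarrow> \<exists>U. open U \<and> x \<in> U \<and> stable_set f \<epsilon> U"
  shows "equicontinuity_point f x"
  unfolding equicontinuity_point_def
proof (intro allI impI)
  fix \<epsilon> :: real assume "\<epsilon> > 0"
  \<comment> \<open>Halving turns the non-strict bound of \<open>stable_set\<close> into a strict
    one.\<close>
  then obtain U where U: "open U" "x \<in> U" "stable_set f (\<epsilon> / 2) U"
    using assms[of "\<epsilon> / 2"] by auto
  then obtain \<delta> where "\<delta> > 0" "ball x \<delta> \<subseteq> U"
    using open_contains_ball by blast
  moreover have "dist (nds_iter f 1 n x) (nds_iter f 1 n y) < \<epsilon>" if "y \<in> U" for y n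
    using stable_setD[OF U(3,2) that, of n] \<open>\<epsilon> > 0\<close> by linarith
  ultimately show "\<exists>\<delta>>0. \<forall>y\<in>ball x \<delta>. \<forall>n. dist (nds_iter f 1 n x) (nds_iter f 1 n y) < \<epsilon>"
    by blast
qed

text \<open>A compact Hausdorff space is locally compact and regular, so Baire's theorem for
  abstract topologies applies.\<close>

lemma Baire_compact_UNIV:
  fixes G :: "nat \<Rightarrow> 'a::metric_space set"
  assumes "compact (UNIV :: 'a set)" "\<And>n. open (G n)" "\<And>n. closure (G n) = UNIV"
  shows "closure (\<Inter>n. G n) = UNIV"
proof -
  let ?X = "euclidean :: 'a topology"
  have "compact_space ?X"
    using assms(1) by (simp add: compact_space_def)
  then have "locally_compact_space ?X \<and> regular_space ?X"
    by (simp add: compact_imp_locally_compact_space compact_Hausdorff_imp_regular_space)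
  then have "?X closure_of (\<Inter>n. G n) = topspace ?X"
    using assms(2,3) by (intro Baire_category) auto
  then show ?thesis by simp
qed

theorem theorem5:
  fixes f :: "nat \<Rightarrow> 'a::metric_space \<Rightarrow> 'a"
  assumes "compact (UNIV :: 'a set)"
    and "nds f"
    and "finitely_generated f"
    and "topologically_transitive f"
    and "commutative_nds f"
  shows "sensitive f \<or> almost_equicontinuous f"
proof (cases "sensitive f")
  case not_sens: False
  define G where "G n = \<Union>{U. open U \<and> stable_set f (1 / real (Suc n)) U}" for n
  have "closure (G n) = UNIV" for n
  proof -
    \<comment> \<open>Non-sensitivity gives a stable set somewhere; \<open>stable_subset\<close>
      carries it into \<open>V\<close> at three times the tolerance.\<close>
    have "G n \<inter> V \<noteq> {}" if V: "open V" "V \<noteq> {}" for V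
    proof -
      obtain U where U: "open U" "U \<noteq> {}" "stable_set f (1 / real (Suc n) / 3) U"
        using not_sensitive_stable_set[OF not_sens, of "1 / real (Suc n) / 3"] by auto
      obtain V' where "open V'" "V' \<noteq> {}" "V' \<subseteq> V" "stable_set f (1 / real (Suc n)) V'"
        using stable_subset[OF assms(1,2,4,5) U V] by blast
      moreover from this have "V' \<subseteq> G n"
        unfolding G_def by blast
      ultimately show ?thesis by blast
    qed
    then show ?thesis
      using dense_intersects_open[of euclidean "G n"] by simp
  qed
  then have "closure (\<Inter>n. G n) = UNIV"
    by (intro Baire_compact_UNIV assms(1)) (auto simp: G_def)
  moreover have "equicontinuity_point f x" if "x \<in> (\<Inter>n. G n)" for x
  proof (rule equicontinuity_pointI)
    fix \<epsilon> :: real assume "\<epsilon> > 0"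
    then obtain n where n: "1 / real (Suc n) < \<epsilon>"
      using nat_approx_posE by blast
    have "x \<in> G n"
      using that by blast
    then obtain U where U: "open U" "x \<in> U" "stable_set f (1 / real (Suc n)) U"
      unfolding G_def by blast
    have "stable_set f \<epsilon> U"
      using U(3) n unfolding stable_set_def by (meson less_imp_le order_trans)
    then show "\<exists>U. open U \<and> x \<in> U \<and> stable_set f \<epsilon> U"
      using U by blast
  qed
  then have "closure (\<Inter>n. G n) \<subseteq> closure {x. equicontinuity_point f x}"
    by (intro closure_mono) blast
  ultimately show ?thesis
    unfolding almost_equicontinuous_def by blast
qed simp

end
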